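(* Let $\omega_1,\omega_2,\dots,\omega_n\in\overline{\mathcal{H}}_2=\mathcal{H}_2\cup\mathbb{R}\mathbb{P}^1$ be such that for all $i$, $\omega_i$ is not in the hyperbolic convex hull of $\omega_1,\dots,\omega_{i-1}$. Then the hyperbolic convex hull of $\omega_1,\dots,\omega_n$ parametrizes the linear combinations $\sum_{i=1}^n\lambda_iQ_{\omega_i}$ with $\lambda_i\ge 0$ and $\sum_{i=1}^n\lambda_i=1$; that is, the set of zeros $\xi\left(\sum_{i=1}^n\lambda_iQ_{\omega_i}\right)$ of all such combinations is exactly the hyperbolic convex hull of $\omega_1,\dots,\omega_n$.
   Context: $\mathcal{H}_2$ is the upper half-plane model of the hyperbolic plane, with boundary $\partial\mathcal{H}_2=\mathbb{R}\mathbb{P}^1=\mathbb{R}\cup\{\infty\}$. Convex hulls are taken in $\overline{\mathcal{H}}_2$: the hyperbolic convex hull of a finite set is the smallest subset of $\overline{\mathcal{H}}_2$ containing it and containing, with any two of its points, the hyperbolic segment joining them (the closed arc of the hyperbolic geodesic between them, ideal endpoints included); the convex hull of the empty set is empty. For $\omega\in\mathcal{H}_2$ put $Q_\omega(X,Z)=(X-\omega Z)(X-\bar\omega Z)$; for $a\in\mathbb{R}$ put $Q_a(X,Z)=(X-aZ)^2$; and put $Q_\infty(X,Z)=Z^2$. A real binary quadratic form $aX^2-2bXZ+cZ^2$ with $\Delta=ac-b^2>0$ and $a>0$ is called positive definite; its zero is $\xi(aX^2-2bXZ+cZ^2)=\frac{b}{a}+\mathbf{i}\frac{\sqrt{\Delta}}{a}\in\mathcal{H}_2$.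 For forms that are positive multiples of $Q_a$ ($a\in\mathbb{R}$) or of $Q_\infty$, the zero is $a$, respectively $\infty$, in the boundary. Thus a form is represented by $\omega\in\overline{\mathcal{H}}_2$ if and only if it is a positive multiple of $Q_\omega$. *)

theory Defs
  imports "HOL-Analysis.Analysis"
begin

section \<open>The closed hyperbolic plane\<close>

datatype hpoint = Pt complex | Infty

text \<open>Only the points of \<open>H2_closed\<close> are meant; \<open>Pt z\<close> with \<open>Im z = 0\<close> is an ideal point, and \<open>Pt z\<close>
  with \<open>Im z < 0\<close> is never used.\<close>

definition H2_closed :: "hpoint set" where
  "H2_closed = insert Infty {Pt z | z. 0 \<le> Im z}"

text \<open>Geodesics are the vertical half-lines and the half-circles centred at a point \<open>c\<close> of the real
  axis. In the last case \<open>c\<close> is uniquely determined, because \<open>Re z \<noteq> Re w\<close>.\<close>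

fun hsegment :: "hpoint \<Rightarrow> hpoint \<Rightarrow> hpoint set" where
  "hsegment Infty Infty = {Infty}"
| "hsegment Infty (Pt w) = insert Infty {Pt u | u. Re u = Re w \<and> Im w \<le> Im u}"
| "hsegment (Pt z) Infty = insert Infty {Pt u | u. Re u = Re z \<and> Im z \<le> Im u}"
| "hsegment (Pt z) (Pt w) =
    (if Re z = Re w then Pt ` closed_segment z w
     else {Pt u | u. 0 \<le> Im u \<and> Re u \<in> closed_segment (Re z) (Re w) \<and>
             (\<exists>c::real. dist u (of_real c) = dist z (of_real c) \<and>
                        dist w (of_real c) = dist z (of_real c))})"

definition hconvex :: "hpoint set \<Rightarrow> bool" where
  "hconvex S \<longleftrightarrow> S \<subseteq> H2_closed \<and> (\<forall>z\<in>S. \<forall>w\<in>S. hsegment z w \<subseteq> S)"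

lemma hsegment_closed:
  assumes "z \<in> H2_closed" "w \<in> H2_closed"
  shows "hsegment z w \<subseteq> H2_closed"
proof (cases z; cases w)
  fix a b assume zw: "z = Pt a" "w = Pt b"
  with assms have ab: "0 \<le> Im a" "0 \<le> Im b" by (auto simp: H2_closed_def)
  have "closed_segment a b \<subseteq> {u. 0 \<le> Im u}"
    by (rule closed_segment_subset) (use ab convex_halfspace_Im_ge in auto)
  then show ?thesis using zw by (auto simp: H2_closed_def)
qed (use assms in \<open>auto simp: H2_closed_def\<close>)

lemma hsegment_ends:
  assumes "z \<in> H2_closed" "w \<in> H2_closed"
  shows "z \<in> hsegment z w" "w \<in> hsegment z w"
proof -
  have center: "\<exists>c::real. dist b (of_real c) = dist a (of_real c)" if "Re a \<noteq> Re b" for a b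
  proof
    let ?c = "((Re b)\<^sup>2 + (Im b)\<^sup>2 - (Re a)\<^sup>2 - (Im a)\<^sup>2) / (2 * (Re b - Re a))"
    have c: "2 * (Re b - Re a) * ?c = (Re b)\<^sup>2 + (Im b)\<^sup>2 - (Re a)\<^sup>2 - (Im a)\<^sup>2" using that by simp
    define c where "c = ?c"
    have "(Re b - c)\<^sup>2 + (Im b)\<^sup>2 = (Re a - c)\<^sup>2 + (Im a)\<^sup>2"
      using c unfolding c_def[symmetric] by (simp add: power2_eq_square algebra_simps)
    then show "dist b (of_real ?c) = dist a (of_real ?c)"
      unfolding c_def[symmetric] by (simp add: dist_complex_def cmod_def)
  qed
  show "z \<in> hsegment z w" "w \<in> hsegment z w"
    using assms by (cases z; cases w; auto simp: H2_closed_def dest!: center)+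
qed

lemma hconvex_H2_closed: "hconvex H2_closed"
  by (simp add: hconvex_def hsegment_closed)

lemma hconvex_Inter:
  assumes "\<And>T. T \<in> F \<Longrightarrow> hconvex T" "F \<noteq> {}"
  shows "hconvex (\<Inter>F)"
  using assms unfolding hconvex_def by blast

lemma hconvex_empty: "hconvex {}"
  by (simp add: hconvex_def)

definition hconvex_hull :: "hpoint set \<Rightarrow> hpoint set" where
  "hconvex_hull S = hconvex hull S"

lemma hconvex_hull_smallest:
  assumes "S \<subseteq> H2_closed"
  shows "hconvex (hconvex_hull S)" "S \<subseteq> hconvex_hull S"
    and "\<And>T. hconvex T \<Longrightarrow> S \<subseteq> T \<Longrightarrow> hconvex_hull S \<subseteq> T"
proof -
  show "hconvex (hconvex_hull S)"
    unfolding hconvex_hull_def hull_def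
    by (rule hconvex_Inter) (use assms hconvex_H2_closed in auto)
  show "S \<subseteq> hconvex_hull S" unfolding hconvex_hull_def by (rule hull_subset)
  show "\<And>T. hconvex T \<Longrightarrow> S \<subseteq> T \<Longrightarrow> hconvex_hull S \<subseteq> T"
    unfolding hconvex_hull_def by (simp add: hull_minimal)
qed

lemma hconvex_hull_empty: "hconvex_hull {} = {}"
  using hconvex_hull_smallest(3)[OF _ hconvex_empty] by simp


section \<open>Real binary quadratic forms and their zeros\<close>

text \<open>A form is identified with the function of \<open>(X, Z)\<close> it defines, which determines its
  coefficients (lemma \<open>bqf_inject\<close>).\<close>

type_synonym form = "real \<Rightarrow> real \<Rightarrow> real"

definition bqf :: "real \<Rightarrow> real \<Rightarrow> real \<Rightarrow> form" where
  "bqf a b c = (\<lambda>X Z. a * X\<^sup>2 - 2 * b * X * Z + c * Z\<^sup>2)"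

text \<open>\<open>Re\<close> only converts the type: the product is real (lemma \<open>of_real_Q_Pt\<close>), and for real \<open>\<omega>\<close> it
  is \<open>(X - \<omega> Z)\<^sup>2\<close> (lemma \<open>Q_real\<close>).\<close>

fun Q :: "hpoint \<Rightarrow> form" where
  "Q (Pt \<omega>) = (\<lambda>X Z. Re ((of_real X - \<omega> * of_real Z) * (of_real X - cnj \<omega> * of_real Z)))"
| "Q Infty = (\<lambda>X Z. Z\<^sup>2)"

inductive has_zero :: "form \<Rightarrow> hpoint \<Rightarrow> bool" where
  pos_def: "a > 0 \<Longrightarrow> a * c - b\<^sup>2 > 0 \<Longrightarrow>
    has_zero (bqf a b c) (Pt (Complex (b / a) (sqrt (a * c - b\<^sup>2) / a)))"
| real: "t > 0 \<Longrightarrow> has_zero (\<lambda>X Z. t * Q (Pt (of_real a)) X Z) (Pt (of_real a))"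
| infty: "t > 0 \<Longrightarrow> has_zero (\<lambda>X Z. t * Q Infty X Z) Infty"

definition \<xi> :: "form \<Rightarrow> hpoint" where
  "\<xi> q = (THE \<omega>. has_zero q \<omega>)"

lemma bqf_inject: "bqf a b c = bqf a' b' c' \<longleftrightarrow> a = a' \<and> b = b' \<and> c = c'"
proof
  assume "bqf a b c = bqf a' b' c'"
  then have "bqf a b c X Z = bqf a' b' c' X Z" for X Z by simp
  from this[of 1 0] this[of 0 1] this[of 1 1] show "a = a' \<and> b = b' \<and> c = c'"
    by (simp add: bqf_def)
qed simp

lemma of_real_Q_Pt:
  "complex_of_real (Q (Pt \<omega>) X Z) = (of_real X - \<omega> * of_real Z) * (of_real X - cnj \<omega> * of_real Z)"
  by (simp add: complex_eq_iff algebra_simps)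

lemma Q_real: "Q (Pt (of_real a)) X Z = (X - a * Z)\<^sup>2"
  by (simp add: power2_eq_square)

lemma Q_Pt_bqf: "Q (Pt \<omega>) = bqf 1 (Re \<omega>) ((Re \<omega>)\<^sup>2 + (Im \<omega>)\<^sup>2)"
  by (intro ext) (simp add: bqf_def power2_eq_square algebra_simps)

lemma Q_Infty_bqf: "Q Infty = bqf 0 0 1"
  by (intro ext) (simp add: bqf_def)

lemma scale_bqf: "(\<lambda>X Z. t * bqf a b c X Z) = bqf (t * a) (t * b) (t * c)"
  by (intro ext) (simp add: bqf_def algebra_simps)

lemma has_zero_iff:
  "has_zero q \<omega> \<longleftrightarrow> \<omega> \<in> H2_closed \<and> (\<exists>t>0. q = (\<lambda>X Z. t * Q \<omega> X Z))"
proof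
  assume "has_zero q \<omega>"
  then show "\<omega> \<in> H2_closed \<and> (\<exists>t>0. q = (\<lambda>X Z. t * Q \<omega> X Z))"
  proof cases
    case (pos_def a c b)
    let ?w = "Complex (b / a) (sqrt (a * c - b\<^sup>2) / a)"
    have "q = (\<lambda>X Z. a * Q (Pt ?w) X Z)"
      using pos_def unfolding Q_Pt_bqf scale_bqf
      by (simp add: bqf_inject power_divide) (simp add: field_simps power2_eq_square)
    then show ?thesis using pos_def by (auto simp: H2_closed_def)
  qed (auto simp: H2_closed_def)
next
  assume *: "\<omega> \<in> H2_closed \<and> (\<exists>t>0. q = (\<lambda>X Z. t * Q \<omega> X Z))"
  then obtain t where t: "t > 0" "q = (\<lambda>X Z. t * Q \<omega> X Z)" by blast
  show "has_zero q \<omega>"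
  proof (cases \<omega>)
    case Infty
    then show ?thesis using t has_zero.infty by simp
  next
    case (Pt w)
    with * have im: "0 \<le> Im w" by (auto simp: H2_closed_def)
    show ?thesis
    proof (cases "Im w = 0")
      case True
      then have "w = of_real (Re w)" by (simp add: complex_eq_iff)
      then show ?thesis using has_zero.real[OF t(1), of "Re w"] t(2) Pt by metis
    next
      case False
      let ?b = "t * Re w" and ?c = "t * ((Re w)\<^sup>2 + (Im w)\<^sup>2)"
      have q: "q = bqf t ?b ?c" using t(2) by (simp add: Pt Q_Pt_bqf scale_bqf del: Q.simps)
      have d: "t * ?c - ?b\<^sup>2 = (t * Im w)\<^sup>2"
        by (simp add: power2_eq_square algebra_simps)
      then have pos: "t * ?c - ?b\<^sup>2 > 0" using t False by simp
      have "Complex (?b / t) (sqrt (t * ?c - ?b\<^sup>2) / t) = w"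
        unfolding d using t im by (simp add: complex_eq_iff)
      with has_zero.pos_def[OF t(1) pos] show ?thesis by (simp only: q Pt)
    qed
  qed
qed

lemma has_zero_unique:
  assumes "has_zero q z" "has_zero q w"
  shows "z = w"
proof -
  obtain s t where st: "s > 0" "t > 0" "(\<lambda>X Z. s * Q z X Z) = (\<lambda>X Z. t * Q w X Z)"
    and cl: "z \<in> H2_closed" "w \<in> H2_closed"
    using assms unfolding has_zero_iff by auto
  show ?thesis
    using st cl
    by (cases z; cases w)
      (auto simp: Q_Pt_bqf Q_Infty_bqf scale_bqf bqf_inject H2_closed_def complex_eq_iff
         simp del: Q.simps)
qed

lemma \<xi>_eq: "has_zero q \<omega> \<Longrightarrow> \<xi> q = \<omega>"
  unfolding \<xi>_def using has_zero_unique by blast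

end

theory Submission
  imports Defs
begin

text \<open>
  Up to a positive factor, the nonzero nonnegative forms are exactly the forms \<open>Q u\<close> with \<open>u\<close> in the
  closed hyperbolic plane (lemmas \<open>nonneg_form_has_zero\<close> and \<open>has_zero_iff\<close>). So \<open>u \<mapsto> Q u\<close> identifies the
  closed plane with the projectivised cone of these forms: this is the passage from the half-plane to the
  Klein model, in which geodesics become straight lines. Concretely, the coefficients of \<open>Q (Pt u)\<close>
  are \<open>1\<close>, \<open>Re u\<close>, \<open>\<bar>u\<bar>\<^sup>2\<close>, and the equation \<open>\<bar>u\<bar>\<^sup>2 - 2 c Re u = const\<close> of a circle centred at
  the real point \<open>c\<close>, like the equation \<open>Re u = const\<close> of a vertical line, is affine in them.
  Hence the hyperbolic segment from \<open>z\<close> to \<open>w\<close> consists of the zeros of the nonnegative combinations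
  of \<open>Q z\<close> and \<open>Q w\<close> (lemma \<open>mem_hsegment_iff\<close>).

  With segments understood, hyperbolic convexity becomes linear convexity. The zeros of nonnegative
  combinations of the \<open>Q (\<omega> i)\<close> form a hyperbolically convex set, since a combination of two combinations
  is again one; and every hyperbolically convex set that contains the \<open>\<omega> i\<close> contains these zeros, as one
  sees by adding the summands one at a time, each addition moving the zero along a segment.
  Finally, a zero does not change when the form is rescaled, so the coefficients may be normalised
  to have sum \<open>1\<close>.
\<close>

section \<open>Nonnegative forms and their zeros\<close>

lemma Q_nonneg: "0 \<le> Q u X Z"
proof (cases u)
  case (Pt v)
  have "Q u X Z = (X - Re v * Z)\<^sup>2 + (Im v * Z)\<^sup>2"
    by (simp add: Pt power2_eq_square algebra_simps)
  then show ?thesis by simp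
qed simp

text \<open>The value at \<open>(b, a)\<close> is \<open>a (a c - b\<^sup>2)\<close>, which bounds the discriminant if \<open>a > 0\<close>. If
  \<open>a = 0\<close>, then the form is linear in \<open>X\<close>, so \<open>b = 0\<close> and the zero is at infinity.\<close>

lemma nonneg_form_has_zero:
  assumes nn: "\<And>X Z. 0 \<le> bqf a b c X Z" and nz: "bqf a b c X0 Z0 \<noteq> 0"
  shows "\<exists>u. has_zero (bqf a b c) u"
proof (cases "a = 0")
  case True
  have "b = 0"
  proof (rule ccontr)
    assume "b \<noteq> 0"
    then have "bqf a b c ((c + 1) / (2 * b)) 1 = -1" by (simp add: bqf_def True)
    with nn[of "(c + 1) / (2 * b)" 1] show False by simp
  qed
  moreover from this True nz have "c \<noteq> 0" by (auto simp: bqf_def)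
  moreover have "0 \<le> c" using nn[of 0 1] by (simp add: bqf_def)
  ultimately have "has_zero (bqf a b c) Infty"
    using has_zero.infty[of c] True by (simp add: bqf_def)
  then show ?thesis ..
next
  case False
  have a: "0 < a" using nn[of 1 0] False by (simp add: bqf_def)
  have "bqf a b c b a = a * (a * c - b\<^sup>2)" by (simp add: bqf_def power2_eq_square algebra_simps)
  then have d: "0 \<le> a * c - b\<^sup>2" using nn[of b a] a by (simp add: zero_le_mult_iff)
  show ?thesis
  proof (cases "a * c - b\<^sup>2 = 0")
    case True
    have "bqf a b c = (\<lambda>X Z. a * Q (Pt (of_real (b / a))) X Z)"
      unfolding Q_Pt_bqf scale_bqf bqf_inject using a True
      by (simp add: field_simps power2_eq_square)
    then show ?thesis using has_zero.real[OF a, of "b / a"] by metis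
  next
    case False
    then show ?thesis using has_zero.pos_def[OF a, of c b] d by auto
  qed
qed

lemma bqf_add: "(\<lambda>X Z. bqf a b c X Z + bqf a' b' c' X Z) = bqf (a + a') (b + b') (c + c')"
  by (intro ext) (simp add: bqf_def algebra_simps)

lemma Q_is_bqf: "\<exists>a b c. Q u = bqf a b c"
  by (cases u) (metis Q_Pt_bqf, metis Q_Infty_bqf)

lemma sum_Q_is_bqf:
  assumes "finite I"
  shows "\<exists>a b c. (\<lambda>X Z. \<Sum>i\<in>I. l i * Q (\<omega> i) X Z) = bqf a b c"
  using assms
proof (induction I)
  case empty
  have "(\<lambda>X Z. 0) = bqf 0 0 0" by (intro ext) (simp add: bqf_def)
  then show ?case by auto
next
  case (insert j I)
  then obtain a b c where IH: "(\<lambda>X Z. \<Sum>i\<in>I. l i * Q (\<omega> i) X Z) = bqf a b c" by blast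
  obtain a' b' c' where Q: "Q (\<omega> j) = bqf a' b' c'" using Q_is_bqf by blast
  have "(\<lambda>X Z. \<Sum>i\<in>insert j I. l i * Q (\<omega> i) X Z)
      = (\<lambda>X Z. bqf (l j * a') (l j * b') (l j * c') X Z + bqf a b c X Z)"
    using insert.hyps by (simp add: Q flip: IH scale_bqf)
  then show ?case unfolding bqf_add by blast
qed

lemma has_zeroE:
  assumes "has_zero q u"
  obtains t where "u \<in> H2_closed" "0 < t" "\<And>X Z. q X Z = t * Q u X Z"
  using assms that unfolding has_zero_iff by force

text \<open>No cancellation can occur between nonnegative forms, so a combination with a positive
  coefficient is not the zero form.\<close>

lemma combination_has_zero:
  assumes I: "finite I" "j \<in> I" and l: "\<And>i. i \<in> I \<Longrightarrow> 0 \<le> l i" "l j \<noteq> 0"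
  shows "\<exists>u. has_zero (\<lambda>X Z. \<Sum>i\<in>I. l i * Q (\<omega> i) X Z) u"
proof -
  obtain a b c where q: "(\<lambda>X Z. \<Sum>i\<in>I. l i * Q (\<omega> i) X Z) = bqf a b c"
    using sum_Q_is_bqf[OF I(1)] by blast
  then have q': "bqf a b c X Z = (\<Sum>i\<in>I. l i * Q (\<omega> i) X Z)" for X Z
    by (simp flip: q)
  obtain X0 Z0 where "Q (\<omega> j) X0 Z0 \<noteq> 0"
  proof (cases "\<omega> j")
    case Infty
    then show ?thesis using that[of 0 1] by simp
  next
    case (Pt v)
    then show ?thesis using that[of 1 0] by simp
  qed
  then have "bqf a b c X0 Z0 \<noteq> 0"
    unfolding q' using I l by (subst sum_nonneg_eq_0_iff) (auto simp: Q_nonneg)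
  moreover have "0 \<le> bqf a b c X Z" for X Z
    unfolding q' by (intro sum_nonneg mult_nonneg_nonneg l Q_nonneg)
  ultimately show ?thesis unfolding q by (intro nonneg_form_has_zero)
qed

lemma zero_form_no_zero: "\<not> has_zero (\<lambda>X Z. 0) u"
proof
  assume "has_zero (\<lambda>X Z. 0) u"
  then obtain t where t: "0 < t" "(\<lambda>X Z. 0) = (\<lambda>X Z. t * Q u X Z)" unfolding has_zero_iff by blast
  then have "t * Q u X Z = 0" for X Z by metis
  from this[of 1 0] this[of 0 1] t(1) show False by (cases u) auto
qed

lemma has_zero_scale:
  assumes "0 < t" "has_zero q u"
  shows "has_zero (\<lambda>X Z. t * q X Z) u"
proof -
  obtain s where s: "u \<in> H2_closed" "0 < s" "q = (\<lambda>X Z. s * Q u X Z)"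
    using assms(2) unfolding has_zero_iff by blast
  then have "(\<lambda>X Z. t * q X Z) = (\<lambda>X Z. (t * s) * Q u X Z)" by (simp add: mult.assoc)
  then show ?thesis using s assms(1) unfolding has_zero_iff by (metis mult_pos_pos)
qed

section \<open>Segments as combinations of two forms\<close>

text \<open>The point \<open>(Re u, \<bar>u\<bar>\<^sup>2)\<close> is the image of \<open>u\<close> in the Klein model, here bounded by a parabola:
  the affine chart of the projectivised cone of forms in which the first coefficient is \<open>1\<close>.\<close>

definition parabola_lift :: "complex \<Rightarrow> real \<times> real" where
  "parabola_lift u = (Re u, (cmod u)\<^sup>2)"

text \<open>Multiples of \<open>Q (Pt u)\<close> are determined by their coefficients, and comparing the first ones gives
  the factor \<open>s + t\<close>. The weights of the two ends in the chart are then \<open>s\<close> and \<open>t\<close> divided by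
  \<open>s + t\<close>.\<close>

lemma has_zero_Pt_combination_iff:
  "(\<exists>s\<ge>0. \<exists>t\<ge>0. has_zero (\<lambda>X Z. s * Q (Pt z) X Z + t * Q (Pt w) X Z) (Pt u)) \<longleftrightarrow>
   0 \<le> Im u \<and> parabola_lift u \<in> closed_segment (parabola_lift z) (parabola_lift w)"
proof -
  have comb: "(\<lambda>X Z. s * Q (Pt z) X Z + t * Q (Pt w) X Z)
      = bqf (s + t) (s * Re z + t * Re w) (s * (cmod z)\<^sup>2 + t * (cmod w)\<^sup>2)" for s t
    by (intro ext) (simp add: Q_Pt_bqf bqf_def cmod_power2 algebra_simps del: Q.simps)
  have zero: "has_zero (bqf a b c) (Pt u) \<longleftrightarrow>
      0 \<le> Im u \<and> 0 < a \<and> b = a * Re u \<and> c = a * (cmod u)\<^sup>2" for a b c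
    unfolding has_zero_iff Q_Pt_bqf scale_bqf bqf_inject by (auto simp: H2_closed_def cmod_power2)
  show ?thesis (is "?L \<longleftrightarrow> ?R")
  proof
    assume ?L
    then obtain s t where st: "0 \<le> s" "0 \<le> t" "0 < s + t" and im: "0 \<le> Im u"
      and e: "s * Re z + t * Re w = (s + t) * Re u"
        "s * (cmod z)\<^sup>2 + t * (cmod w)\<^sup>2 = (s + t) * (cmod u)\<^sup>2"
      unfolding comb zero by blast
    let ?r = "t / (s + t)"
    have r: "1 - ?r = s / (s + t)" using st by (simp add: field_simps)
    have weights: "x = (1 - ?r) * y + ?r * y'" if "s * y + t * y' = (s + t) * x" for x y y'
    proof -
      have "(1 - ?r) * y + ?r * y' = (s * y + t * y') / (s + t)"
        unfolding r by (simp add: add_divide_distrib)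
      then show ?thesis using that st by simp
    qed
    have "Re u = (1 - ?r) * Re z + ?r * Re w" "(cmod u)\<^sup>2 = (1 - ?r) * (cmod z)\<^sup>2 + ?r * (cmod w)\<^sup>2"
      by (rule weights, fact e)+
    moreover have "0 \<le> ?r" "?r \<le> 1" using st by auto
    ultimately show ?R using im unfolding in_segment parabola_lift_def by (intro conjI exI[of _ ?r]) auto
  next
    assume ?R
    then obtain r where r: "0 \<le> r" "r \<le> 1" and im: "0 \<le> Im u"
      and e: "Re u = (1 - r) * Re z + r * Re w" "(cmod u)\<^sup>2 = (1 - r) * (cmod z)\<^sup>2 + r * (cmod w)\<^sup>2"
      unfolding in_segment parabola_lift_def by auto
    show ?L
      unfolding comb zero using r im e by (intro exI[of _ "1 - r"] conjI exI[of _ r]) auto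
  qed
qed

lemma dist_real_center_eq_iff:
  fixes z w :: complex and c :: real
  shows "dist z (of_real c) = dist w (of_real c) \<longleftrightarrow>
    (cmod z)\<^sup>2 - 2 * c * Re z = (cmod w)\<^sup>2 - 2 * c * Re w"
proof -
  have "dist z (of_real c) = dist w (of_real c) \<longleftrightarrow> (dist z (of_real c))\<^sup>2 = (dist w (of_real c))\<^sup>2"
    by (rule power2_eq_iff_nonneg[symmetric]) auto
  also have "\<dots> \<longleftrightarrow> (cmod z)\<^sup>2 - 2 * c * Re z = (cmod w)\<^sup>2 - 2 * c * Re w"
    unfolding dist_complex_def cmod_power2 by (auto simp: power2_eq_square algebra_simps)
  finally show ?thesis .
qed

text \<open>On a vertical half-line above the real axis, the second coordinate of the lift is an increasing
  function of the height, so it maps intervals of heights to intervals.\<close>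

lemma vertical_segment_lift:
  assumes im: "0 \<le> Im z" "0 \<le> Im w" and re: "Re z = Re w"
  shows "u \<in> closed_segment z w \<longleftrightarrow>
    0 \<le> Im u \<and> parabola_lift u \<in> closed_segment (parabola_lift z) (parabola_lift w)"
proof -
  have seg: "u \<in> closed_segment z w \<longleftrightarrow> Re u = Re w \<and> Im u \<in> closed_segment (Im z) (Im w)"
    using closed_segment_same_Re[OF re] re by auto
  have "parabola_lift u \<in> closed_segment (parabola_lift z) (parabola_lift w) \<longleftrightarrow>
      Re u = Re w \<and> (cmod u)\<^sup>2 \<in> closed_segment ((cmod z)\<^sup>2) ((cmod w)\<^sup>2)"
    unfolding in_segment parabola_lift_def re by (auto simp: algebra_simps)
  also have "\<dots> \<longleftrightarrow> Re u = Re w \<and> (Im u)\<^sup>2 \<in> closed_segment ((Im z)\<^sup>2) ((Im w)\<^sup>2)"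
    unfolding closed_segment_eq_real_ivl cmod_power2 by (auto simp: re)
  finally show ?thesis
    unfolding seg closed_segment_eq_real_ivl using im
    by (auto split: if_splits simp flip: abs_le_square_iff)
qed

text \<open>The distance condition is affine in the lift, so on the strip over the interval between
  \<open>Re z\<close> and \<open>Re w\<close> it cuts out the segment joining the lifts of \<open>z\<close> and \<open>w\<close>.\<close>

lemma circular_segment_lift:
  assumes re: "Re z \<noteq> Re w"
  shows "(Re u \<in> closed_segment (Re z) (Re w) \<and>
      (\<exists>c::real. dist u (of_real c) = dist z (of_real c) \<and> dist w (of_real c) = dist z (of_real c)))
    \<longleftrightarrow> parabola_lift u \<in> closed_segment (parabola_lift z) (parabola_lift w)" (is "?L \<longleftrightarrow> ?R")
proof
  assume ?L
  then obtain r c where r: "0 \<le> r" "r \<le> 1" "Re u = (1 - r) * Re z + r * Re w"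
    and u: "(cmod u)\<^sup>2 - 2 * c * Re u = (cmod z)\<^sup>2 - 2 * c * Re z"
    and w: "(cmod w)\<^sup>2 - 2 * c * Re w = (cmod z)\<^sup>2 - 2 * c * Re z"
    unfolding dist_real_center_eq_iff by (auto simp: in_segment)
  have "(cmod w)\<^sup>2 = (cmod z)\<^sup>2 - 2 * c * Re z + 2 * c * Re w"
    "(cmod u)\<^sup>2 = (cmod z)\<^sup>2 - 2 * c * Re z + 2 * c * Re u" using u w by auto
  then have "(cmod u)\<^sup>2 = (1 - r) * (cmod z)\<^sup>2 + r * (cmod w)\<^sup>2"
    by (simp add: r(3)) (simp add: algebra_simps)
  then show ?R using r by (auto simp: in_segment parabola_lift_def)
next
  assume ?R
  then obtain r where r: "0 \<le> r" "r \<le> 1" "Re u = (1 - r) * Re z + r * Re w"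
    "(cmod u)\<^sup>2 = (1 - r) * (cmod z)\<^sup>2 + r * (cmod w)\<^sup>2"
    by (auto simp: in_segment parabola_lift_def)
  \<comment> \<open>half the slope of the line through the two lifts\<close>
  define c where "c = ((cmod w)\<^sup>2 - (cmod z)\<^sup>2) / (2 * (Re w - Re z))"
  have "c * (2 * (Re w - Re z)) = (cmod w)\<^sup>2 - (cmod z)\<^sup>2"
    unfolding c_def
    by (rule nonzero_eq_divide_eq[THEN iffD1, OF _ refl]) (use re in simp)
  then have w: "(cmod w)\<^sup>2 = (cmod z)\<^sup>2 - 2 * c * Re z + 2 * c * Re w" by (simp add: algebra_simps)
  then have u: "(cmod u)\<^sup>2 - 2 * c * Re u = (cmod z)\<^sup>2 - 2 * c * Re z"
    by (simp add: r(3,4)) (simp add: algebra_simps)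
  have "Re u \<in> closed_segment (Re z) (Re w)" using r(1-3) by (auto simp: in_segment)
  then show ?L using u w unfolding dist_real_center_eq_iff by auto
qed

lemma Pt_mem_hsegment_Pt_iff:
  assumes "0 \<le> Im z" "0 \<le> Im w"
  shows "Pt u \<in> hsegment (Pt z) (Pt w) \<longleftrightarrow>
    0 \<le> Im u \<and> parabola_lift u \<in> closed_segment (parabola_lift z) (parabola_lift w)"
proof (cases "Re z = Re w")
  case True
  then show ?thesis using vertical_segment_lift[OF assms True] by auto
next
  case False
  then show ?thesis using circular_segment_lift[OF False, of u] by auto
qed

text \<open>Adding \<open>s Z\<^sup>2\<close> to \<open>t Q (Pt w)\<close> raises \<open>\<bar>u\<bar>\<^sup>2\<close> by \<open>s / t\<close> and keeps \<open>Re u\<close>: the zero moves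
  up the vertical line through \<open>w\<close>, and reaches infinity for \<open>t = 0\<close>.\<close>

lemma mem_hsegment_Infty_Pt_iff:
  assumes w: "0 \<le> Im w"
  shows "u \<in> hsegment Infty (Pt w) \<longleftrightarrow>
    (\<exists>s\<ge>0. \<exists>t\<ge>0. has_zero (\<lambda>X Z. s * Q Infty X Z + t * Q (Pt w) X Z) u)"
proof (cases u)
  case Infty
  have "has_zero (\<lambda>X Z. 1 * Q Infty X Z + 0 * Q (Pt w) X Z) Infty"
    using has_zero.infty[of 1] by simp
  then have "\<exists>s\<ge>0. \<exists>t\<ge>0. has_zero (\<lambda>X Z. s * Q Infty X Z + t * Q (Pt w) X Z) Infty"
    using zero_le_one order_refl by blast
  then show ?thesis by (simp add: Infty del: Q.simps)
next
  case (Pt v)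
  have comb: "(\<lambda>X Z. s * Q Infty X Z + t * Q (Pt w) X Z)
      = bqf t (t * Re w) (s + t * (cmod w)\<^sup>2)" for s t
    by (intro ext) (simp add: Q_Pt_bqf bqf_def cmod_power2 algebra_simps del: Q.simps(1))
  have zero: "has_zero (bqf a b c) (Pt v) \<longleftrightarrow>
      0 \<le> Im v \<and> 0 < a \<and> b = a * Re v \<and> c = a * (cmod v)\<^sup>2" for a b c
    unfolding has_zero_iff Q_Pt_bqf scale_bqf bqf_inject by (auto simp: H2_closed_def cmod_power2)
  show ?thesis (is "?L \<longleftrightarrow> ?R")
  proof
    assume ?L
    then have v: "Re v = Re w" "Im w \<le> Im v" by (auto simp: Pt)
    then have "(Im w)\<^sup>2 \<le> (Im v)\<^sup>2" using w by (simp add: power_mono)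
    then have "0 \<le> (cmod v)\<^sup>2 - (cmod w)\<^sup>2" by (simp add: cmod_power2 v)
    then show ?R
      unfolding comb Pt zero using v w
      by (intro exI[of _ "(cmod v)\<^sup>2 - (cmod w)\<^sup>2"] conjI exI[of _ 1]) auto
  next
    assume ?R
    then obtain s t where st: "0 \<le> s" "0 < t" and im: "0 \<le> Im v" and re: "Re v = Re w"
      and e: "s + t * (cmod w)\<^sup>2 = t * (cmod v)\<^sup>2"
      unfolding comb Pt zero by auto
    from e st have "t * (cmod w)\<^sup>2 \<le> t * (cmod v)\<^sup>2" by linarith
    then have "(Im w)\<^sup>2 \<le> (Im v)\<^sup>2" using st by (simp add: cmod_power2 re)
    then have "Im w \<le> Im v" using im by (rule power2_le_imp_le)
    then show ?L using re by (simp add: Pt)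
  qed
qed

lemma hsegment_Infty_commute: "hsegment (Pt z) Infty = hsegment Infty (Pt z)"
  by simp

theorem mem_hsegment_iff:
  assumes "z \<in> H2_closed" "w \<in> H2_closed"
  shows "u \<in> hsegment z w \<longleftrightarrow>
    (\<exists>s\<ge>0. \<exists>t\<ge>0. has_zero (\<lambda>X Z. s * Q z X Z + t * Q w X Z) u)"
proof (cases z)
  case z: Infty
  show ?thesis
  proof (cases w)
    case w: Infty
    have "(\<exists>s\<ge>0. \<exists>t\<ge>0. has_zero (\<lambda>X Z. s * Q z X Z + t * Q w X Z) u) \<longleftrightarrow> u = Infty" (is "?L \<longleftrightarrow> _")
    proof
      assume ?L
      then obtain s t where st: "0 \<le> s" "0 \<le> t"
        and zero: "has_zero (\<lambda>X Z. (s + t) * Q Infty X Z) u"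
        by (auto simp: z w distrib_right)
      have "s + t \<noteq> 0" using zero zero_form_no_zero by auto
      then have "has_zero (\<lambda>X Z. (s + t) * Q Infty X Z) Infty" using st by (intro has_zero.infty) auto
      with zero show "u = Infty" by (rule has_zero_unique)
    next
      assume "u = Infty"
      then have "has_zero (\<lambda>X Z. 1 * Q z X Z + 0 * Q w X Z) u"
        using has_zero.infty[of 1] by (simp add: z)
      then show ?L using zero_le_one order_refl by blast
    qed
    then show ?thesis by (simp add: z w)
  next
    case (Pt b)
    then show ?thesis using mem_hsegment_Infty_Pt_iff assms z by (auto simp: H2_closed_def)
  qed
next
  case z: (Pt a)
  then have a: "0 \<le> Im a" using assms by (auto simp: H2_closed_def)
  show ?thesis
  proof (cases w)
    case Infty
    show ?thesis
      unfolding z Infty hsegment_Infty_commute mem_hsegment_Infty_Pt_iff[OF a]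
      by (subst add.commute) blast
  next
    case w: (Pt b)
    then have b: "0 \<le> Im b" using assms by (auto simp: H2_closed_def)
    show ?thesis
    proof (cases u)
      case (Pt v)
      show ?thesis
        unfolding z w Pt Pt_mem_hsegment_Pt_iff[OF a b] has_zero_Pt_combination_iff ..
    next
      case Infty
      have "\<not> has_zero (\<lambda>X Z. s * Q (Pt a) X Z + t * Q (Pt b) X Z) Infty"
        if st: "0 \<le> s" "0 \<le> t" for s t
      proof
        assume zero: "has_zero (\<lambda>X Z. s * Q (Pt a) X Z + t * Q (Pt b) X Z) Infty"
        then obtain r where "(\<lambda>X Z. s * Q (Pt a) X Z + t * Q (Pt b) X Z) = (\<lambda>X Z. r * Q Infty X Z)"
          unfolding has_zero_iff by blast
        from fun_cong[OF fun_cong[OF this, of 1], of 0] have "s + t = 0" by simp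
        with st have "s = 0" "t = 0" by auto
        with zero show False using zero_form_no_zero by simp
      qed
      then show ?thesis unfolding z w Infty by auto
    qed
  qed
qed

section \<open>Convex hulls as zeros of combinations\<close>

text \<open>Each nonzero partial sum is a positive multiple of \<open>Q v\<close> for its zero \<open>v\<close>. Adding the summand of
  \<open>\<omega> j\<close> therefore gives a combination of just two forms, whose zero lies on the segment from \<open>v\<close>
  to \<open>\<omega> j\<close>.\<close>

lemma combination_zero_in_hconvex:
  assumes T: "hconvex T" and I: "finite I" and \<omega>: "\<omega> ` I \<subseteq> T"
    and l: "\<And>i. i \<in> I \<Longrightarrow> 0 \<le> l i"
    and u: "has_zero (\<lambda>X Z. \<Sum>i\<in>I. l i * Q (\<omega> i) X Z) u"
  shows "u \<in> T"
  using I \<omega> l u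
proof (induction I arbitrary: u)
  case empty
  then show ?case using zero_form_no_zero by simp
next
  case (insert j I)
  have j: "\<omega> j \<in> T" "\<omega> j \<in> H2_closed" using insert.prems T by (auto simp: hconvex_def)
  have split: "(\<lambda>X Z. \<Sum>i\<in>insert j I. l i * Q (\<omega> i) X Z)
      = (\<lambda>X Z. (\<Sum>i\<in>I. l i * Q (\<omega> i) X Z) + l j * Q (\<omega> j) X Z)"
    using insert.hyps by (simp add: add.commute)
  show ?case
    \<comment> \<open>a partial sum without positive coefficient is the zero form and has no zero \<open>v\<close>\<close>
  proof (cases "\<forall>i\<in>I. l i = 0")
    case True
    then have zero: "has_zero (\<lambda>X Z. l j * Q (\<omega> j) X Z) u" using insert.prems(3) by (simp add: split)
    have "l j \<noteq> 0" using zero zero_form_no_zero by auto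
    then have "0 < l j" using insert.prems(2)[of j] by simp
    then have "has_zero (\<lambda>X Z. l j * Q (\<omega> j) X Z) (\<omega> j)" unfolding has_zero_iff using j by blast
    then show ?thesis using zero has_zero_unique j by metis
  next
    case False
    then obtain v where v: "has_zero (\<lambda>X Z. \<Sum>i\<in>I. l i * Q (\<omega> i) X Z) v"
      using combination_has_zero[of I _ l] insert.hyps insert.prems by blast
    then have vT: "v \<in> T" using insert by simp
    from v obtain t where t: "v \<in> H2_closed" "0 < t"
      "(\<lambda>X Z. \<Sum>i\<in>I. l i * Q (\<omega> i) X Z) = (\<lambda>X Z. t * Q v X Z)" unfolding has_zero_iff by blast
    then have "(\<Sum>i\<in>I. l i * Q (\<omega> i) X Z) = t * Q v X Z" for X Z by metis
    then have "has_zero (\<lambda>X Z. t * Q v X Z + l j * Q (\<omega> j) X Z) u"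
      using insert.prems(3) by (simp add: split)
    moreover have "0 \<le> t" "0 \<le> l j" using t insert.prems by auto
    ultimately have "u \<in> hsegment v (\<omega> j)" unfolding mem_hsegment_iff[OF t(1) j(2)] by blast
    then show ?thesis using T vT j unfolding hconvex_def by blast
  qed
qed

text \<open>If \<open>Q z\<close> and \<open>Q w\<close> are nonnegative combinations, up to the positive factors \<open>p\<close> and \<open>r\<close>,
  then so is each nonnegative combination of \<open>Q z\<close> and \<open>Q w\<close>.\<close>

lemma hconvex_combination_zeros:
  "hconvex {u. \<exists>l. (\<forall>i\<in>I. 0 \<le> l i) \<and> has_zero (\<lambda>X Z. \<Sum>i\<in>I. l i * Q (\<omega> i) X Z) u}"
  (is "hconvex ?K")
  unfolding hconvex_def
proof (intro conjI ballI subsetI)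
  fix u assume "u \<in> ?K"
  then show "u \<in> H2_closed" by (elim CollectE exE conjE has_zeroE)
next
  fix z w u assume "z \<in> ?K" "w \<in> ?K" and u: "u \<in> hsegment z w"
  then obtain k l where k: "\<forall>i\<in>I. 0 \<le> k i" "has_zero (\<lambda>X Z. \<Sum>i\<in>I. k i * Q (\<omega> i) X Z) z"
    and l: "\<forall>i\<in>I. 0 \<le> l i" "has_zero (\<lambda>X Z. \<Sum>i\<in>I. l i * Q (\<omega> i) X Z) w"
    by (elim CollectE exE conjE)
  obtain p where p: "z \<in> H2_closed" "0 < p" "\<And>X Z. (\<Sum>i\<in>I. k i * Q (\<omega> i) X Z) = p * Q z X Z"
    using has_zeroE[OF k(2)] by metis
  obtain r where r: "w \<in> H2_closed" "0 < r" "\<And>X Z. (\<Sum>i\<in>I. l i * Q (\<omega> i) X Z) = r * Q w X Z"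
    using has_zeroE[OF l(2)] by metis
  have Qz: "Q z X Z = (\<Sum>i\<in>I. k i * Q (\<omega> i) X Z) / p" for X Z
    unfolding p(3) using p(2) by simp
  have Qw: "Q w X Z = (\<Sum>i\<in>I. l i * Q (\<omega> i) X Z) / r" for X Z
    unfolding r(3) using r(2) by simp
  obtain s t where st: "0 \<le> s" "0 \<le> t" "has_zero (\<lambda>X Z. s * Q z X Z + t * Q w X Z) u"
    using u unfolding mem_hsegment_iff[OF p(1) r(1)] by blast
  let ?m = "\<lambda>i. s / p * k i + t / r * l i"
  have "(\<lambda>X Z. s * Q z X Z + t * Q w X Z) = (\<lambda>X Z. \<Sum>i\<in>I. ?m i * Q (\<omega> i) X Z)"
    unfolding Qz Qw by (simp add: sum.distrib distrib_right sum_distrib_left sum_divide_distrib mult.assoc)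
  then have "has_zero (\<lambda>X Z. \<Sum>i\<in>I. ?m i * Q (\<omega> i) X Z) u" using st(3) by (simp only:)
  moreover have "\<forall>i\<in>I. 0 \<le> ?m i" using st k l p r by simp
  ultimately show "u \<in> ?K" by (intro CollectI exI[of _ ?m] conjI)
qed

theorem hconvex_hull_eq_combination_zeros:
  assumes I: "finite I" and \<omega>: "\<omega> ` I \<subseteq> H2_closed"
  shows "hconvex_hull (\<omega> ` I) =
    {u. \<exists>l. (\<forall>i\<in>I. 0 \<le> l i) \<and> has_zero (\<lambda>X Z. \<Sum>i\<in>I. l i * Q (\<omega> i) X Z) u}" (is "_ = ?K")
proof (rule antisym)
  have "\<omega> j \<in> ?K" if j: "j \<in> I" for j
  proof -
    have "(\<lambda>X Z. \<Sum>i\<in>I. of_bool (i = j) * Q (\<omega> i) X Z) = (\<lambda>X Z. 1 * Q (\<omega> j) X Z)"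
      using I j by (simp add: of_bool_def if_distrib[of "\<lambda>x. x * _"] cong: if_cong)
    moreover have "has_zero (\<lambda>X Z. 1 * Q (\<omega> j) X Z) (\<omega> j)"
      unfolding has_zero_iff using \<omega> j zero_less_one by blast
    ultimately have "has_zero (\<lambda>X Z. \<Sum>i\<in>I. of_bool (i = j) * Q (\<omega> i) X Z) (\<omega> j)" by (simp only:)
    then show ?thesis by (intro CollectI exI[of _ "\<lambda>i. of_bool (i = j)"]) simp
  qed
  then show "hconvex_hull (\<omega> ` I) \<subseteq> ?K"
    by (intro hconvex_hull_smallest(3)[OF \<omega>] hconvex_combination_zeros image_subsetI)
next
  show "?K \<subseteq> hconvex_hull (\<omega> ` I)"
    using combination_zero_in_hconvex[OF hconvex_hull_smallest(1)[OF \<omega>] I hconvex_hull_smallest(2)[OF \<omega>]]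
    by blast
qed

theorem proposition4:
  fixes n :: nat and \<omega> :: "nat \<Rightarrow> hpoint"
  assumes "\<And>i. i \<in> {1..n} \<Longrightarrow> \<omega> i \<in> H2_closed"
    and "\<And>i. i \<in> {1..n} \<Longrightarrow> \<omega> i \<notin> hconvex_hull (\<omega> ` {1..<i})"
  shows "{\<xi> (\<lambda>X Z. \<Sum>i=1..n. l i * Q (\<omega> i) X Z) | l :: nat \<Rightarrow> real.
            (\<forall>i\<in>{1..n}. 0 \<le> l i) \<and> (\<Sum>i=1..n. l i) = 1}
         = hconvex_hull (\<omega> ` {1..n})"
  (is "?Z = _")
proof -
  have "\<omega> ` {1..n} \<subseteq> H2_closed" using assms(1) by blast
  note hull = hconvex_hull_eq_combination_zeros[OF finite_atLeastAtMost this]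
  show ?thesis
    unfolding hull
  proof (intro antisym subsetI)
    fix u assume "u \<in> ?Z"
    then obtain l where u: "u = \<xi> (\<lambda>X Z. \<Sum>i=1..n. l i * Q (\<omega> i) X Z)"
      and l: "\<forall>i\<in>{1..n}. 0 \<le> l i" "(\<Sum>i=1..n. l i) = 1" by blast
    have "\<exists>j\<in>{1..n}. l j \<noteq> 0"
    proof (rule ccontr)
      assume "\<not> ?thesis"
      then have "(\<Sum>i=1..n. l i) = 0" by (intro sum.neutral) blast
      with l(2) show False by simp
    qed
    then obtain v where v: "has_zero (\<lambda>X Z. \<Sum>i=1..n. l i * Q (\<omega> i) X Z) v"
      using combination_has_zero[of "{1..n}" _ l] l by blast
    then have "u = v" using u \<xi>_eq by blast
    with v l show "u \<in> {u. \<exists>l. (\<forall>i\<in>{1..n}. 0 \<le> l i) \<and>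
        has_zero (\<lambda>X Z. \<Sum>i=1..n. l i * Q (\<omega> i) X Z) u}" by blast
  next
    fix u assume "u \<in> {u. \<exists>l. (\<forall>i\<in>{1..n}. 0 \<le> l i) \<and>
        has_zero (\<lambda>X Z. \<Sum>i=1..n. l i * Q (\<omega> i) X Z) u}"
    then obtain l where l: "\<forall>i\<in>{1..n}. 0 \<le> l i"
      and u: "has_zero (\<lambda>X Z. \<Sum>i=1..n. l i * Q (\<omega> i) X Z) u" by blast
    define L where "L = (\<Sum>i=1..n. l i)"
    have "L \<noteq> 0"
    proof
      assume "L = 0"
      then have "\<forall>i\<in>{1..n}. l i = 0" using l unfolding L_def by (subst (asm) sum_nonneg_eq_0_iff) auto
      then have "has_zero (\<lambda>X Z. 0) u" using u by simp
      then show False using zero_form_no_zero by blast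
    qed
    moreover have "0 \<le> L" unfolding L_def using l by (intro sum_nonneg) blast
    ultimately have L: "0 < L" by simp
    let ?l = "\<lambda>i. l i / L"
    have "has_zero (\<lambda>X Z. 1 / L * (\<Sum>i=1..n. l i * Q (\<omega> i) X Z)) u"
      using L u by (intro has_zero_scale) auto
    then have "has_zero (\<lambda>X Z. \<Sum>i=1..n. ?l i * Q (\<omega> i) X Z) u" by (simp add: sum_divide_distrib)
    then have "u = \<xi> (\<lambda>X Z. \<Sum>i=1..n. ?l i * Q (\<omega> i) X Z)" using \<xi>_eq by blast
    moreover have "\<forall>i\<in>{1..n}. 0 \<le> ?l i" using l L by simp
    moreover have "(\<Sum>i=1..n. ?l i) = 1" using L by (simp add: L_def flip: sum_divide_distrib)
    ultimately show "u \<in> ?Z" by (intro CollectI exI[of _ ?l] conjI)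
  qed
qed

end
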